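(* Let $m\ge 3$ be an odd integer and let $\beta>1$ be a real number satisfying $\beta^m=\beta^{m-1}+\cdots+\beta+1$. Then $\|\nu_\beta^{(n)}\|=1$ for all $n\ge 1$.
   Context: For $\beta>1$, the signed Bernoulli convolutions $\nu_\beta^{(n)}$ are the finite signed measures on $\mathbb{R}$ defined by $\nu_\beta^{(0)}=\delta_0$ and $\nu_\beta^{(n)}=\nu_\beta^{(n-1)}*\left(\frac12\delta_{\beta^{-n}}-\frac12\delta_{-\beta^{-n}}\right)$ for $n\ge 1$, where $\delta_x$ is the Dirac measure at $x$ and $*$ is convolution of measures. Equivalently, for $n\ge1$, $\nu_\beta^{(n)}=2^{-n}\sum_{\varepsilon\in\{\pm1\}^n}\varepsilon_1\cdots\varepsilon_n\,\delta_{\sum_{j=1}^n\varepsilon_j\beta^{-j}}$. $\|\cdot\|$ denotes the total variation norm of a signed measure. *)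

theory Defs
  imports "HOL-Probability.Probability"
begin

text \<open>
  A finite signed measure on the real line is represented by its real-valued set function, which
  is meaningful on Borel sets only.
\<close>

definition signed_measure :: "(real set \<Rightarrow> real) \<Rightarrow> bool" where
  "signed_measure \<mu> \<longleftrightarrow>
     (\<forall>A :: nat \<Rightarrow> real set. range A \<subseteq> sets borel \<longrightarrow> disjoint_family A \<longrightarrow>
        (\<lambda>i. \<mu> (A i)) sums \<mu> (\<Union>i. A i))"

definition dirac :: "real \<Rightarrow> real set \<Rightarrow> real" where
  "dirac x E = measure (return borel x) E"

text \<open>
  The Jordan decomposition \<open>\<mu> = \<mu>\<^sup>+ - \<mu>\<^sup>-\<close>, with
  \<open>\<mu>\<^sup>+(E) = sup {\<mu>(A). A \<subseteq> E}\<close> and \<open>\<mu>\<^sup>- = (-\<mu>)\<^sup>+\<close>. The coercion \<open>ennreal\<close> sends negative values to 0,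
  which does not affect the supremum, since \<open>A = {}\<close> is admitted.
\<close>

definition pos_part :: "(real set \<Rightarrow> real) \<Rightarrow> real measure" where
  "pos_part \<mu> =
     measure_of UNIV (sets borel) (\<lambda>E. SUP A\<in>{A \<in> sets borel. A \<subseteq> E}. ennreal (\<mu> A))"

definition neg_part :: "(real set \<Rightarrow> real) \<Rightarrow> real measure" where
  "neg_part \<mu> = pos_part (\<lambda>E. - \<mu> E)"

text \<open>
  The bilinear extension to signed measures of the convolution \<open>\<star>\<close> of finite measures.
\<close>

definition signed_conv ::
    "(real set \<Rightarrow> real) \<Rightarrow> (real set \<Rightarrow> real) \<Rightarrow> real set \<Rightarrow> real" where
  "signed_conv \<mu> \<nu> E =
     measure (pos_part \<mu> \<star> pos_part \<nu>) E - measure (pos_part \<mu> \<star> neg_part \<nu>) E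
     - measure (neg_part \<mu> \<star> pos_part \<nu>) E + measure (neg_part \<mu> \<star> neg_part \<nu>) E"

text \<open>
  The total variation norm \<open>|\<mu>|(\<real>)\<close>: the supremum of \<open>\<Sum>i. |\<mu>(A i)|\<close> over all countable Borel
  partitions of the line.
\<close>

definition tv_norm :: "(real set \<Rightarrow> real) \<Rightarrow> ennreal" where
  "tv_norm \<mu> =
     (SUP A\<in>{A :: nat \<Rightarrow> real set. range A \<subseteq> sets borel \<and> disjoint_family A \<and> (\<Union>i. A i) = UNIV}.
        \<Sum>i. ennreal \<bar>\<mu> (A i)\<bar>)"

primrec signed_bernoulli :: "real \<Rightarrow> nat \<Rightarrow> real set \<Rightarrow> real" where
  "signed_bernoulli \<beta> 0 = dirac 0"
| "signed_bernoulli \<beta> (Suc n) =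
     signed_conv (signed_bernoulli \<beta> n)
       (\<lambda>E. 1/2 * dirac (1 / \<beta> ^ Suc n) E - 1/2 * dirac (- (1 / \<beta> ^ Suc n)) E)"

text \<open>
  \<open>measure_of\<close> yields the null measure when its argument is not a measure; the following facts
  show that this does not happen for the Jordan parts of a signed measure.
\<close>

lemma signed_measure_empty:
  assumes "signed_measure \<mu>"
  shows "\<mu> {} = 0"
proof -
  have "range (\<lambda>i::nat. {}) \<subseteq> sets (borel :: real measure)" "disjoint_family (\<lambda>i::nat. {} :: real set)"
    by (simp_all add: disjoint_family_on_def)
  then have "(\<lambda>i::nat. \<mu> {}) sums \<mu> (\<Union>i::nat. {})"
    using assms unfolding signed_measure_def by blast
  then have "(\<lambda>i::nat. \<mu> {}) \<longlonglongrightarrow> 0"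
    by (rule summable_LIMSEQ_zero[OF sums_summable])
  then show ?thesis
    by (simp add: LIMSEQ_const_iff)
qed

lemma signed_measure_Un:
  assumes "signed_measure \<mu>" "A \<in> sets borel" "B \<in> sets borel" "A \<inter> B = {}"
  shows "\<mu> (A \<union> B) = \<mu> A + \<mu> B"
proof -
  have "range (binaryset A B) \<subseteq> sets borel" "disjoint_family (binaryset A B)"
    using assms by (auto simp: range_binaryset_eq disjoint_family_on_def binaryset_def)
  then have "(\<lambda>i. \<mu> (binaryset A B i)) sums \<mu> (\<Union>i. binaryset A B i)"
    using assms(1) unfolding signed_measure_def by blast
  moreover have "(\<lambda>i. \<mu> (binaryset A B i)) sums (\<mu> A + \<mu> B)"
    by (rule binaryset_sums) (rule signed_measure_empty[OF assms(1)])
  ultimately show ?thesis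
    by (simp add: UN_binaryset_eq sums_iff)
qed

lemma emeasure_pos_part:
  assumes \<mu>: "signed_measure \<mu>" and E: "E \<in> sets borel"
  shows "emeasure (pos_part \<mu>) E = (SUP A\<in>{A \<in> sets borel. A \<subseteq> E}. ennreal (\<mu> A))"
proof -
  define f where "f E = (SUP A\<in>{A \<in> sets borel. A \<subseteq> E}. ennreal (\<mu> A))" for E
  have le_f: "ennreal (\<mu> A) \<le> f E" if "A \<in> sets borel" "A \<subseteq> E" for A E
    unfolding f_def by (rule SUP_upper) (use that in auto)
  have mono: "f E \<le> f F" if "E \<subseteq> F" for E F
    unfolding f_def by (rule SUP_subset_mono) (use that in auto)
  have empty: "f {} = 0"
  proof -
    have "{A \<in> sets borel. A \<subseteq> ({} :: real set)} = {{}}" by auto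
    then show ?thesis by (simp add: f_def signed_measure_empty[OF \<mu>])
  qed
  have superadd: "f E + f F \<le> f (E \<union> F)" if EF: "E \<inter> F = {}" for E F
  proof -
    have *: "ennreal (\<mu> A) + ennreal (\<mu> B) \<le> f (E \<union> F)"
      if A: "A \<in> sets borel" "A \<subseteq> E" and B: "B \<in> sets borel" "B \<subseteq> F" for A B
    proof (cases "\<mu> A < 0 \<or> \<mu> B < 0")
      case True
      then show ?thesis
      proof
        assume "\<mu> A < 0"
        then show ?thesis using le_f[of B "E \<union> F"] B by (auto simp: ennreal_neg)
      next
        assume "\<mu> B < 0"
        then show ?thesis using le_f[of A "E \<union> F"] A by (auto simp: ennreal_neg)
      qed
    next
      case False
      then have "ennreal (\<mu> A) + ennreal (\<mu> B) = ennreal (\<mu> (A \<union> B))"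
        using A B EF by (subst signed_measure_Un[OF \<mu>]) (auto simp: ennreal_plus)
      also have "\<dots> \<le> f (E \<union> F)"
        by (rule le_f) (use A B in auto)
      finally show ?thesis .
    qed
    have "f E + ennreal (\<mu> B) \<le> f (E \<union> F)" if B: "B \<in> sets borel" "B \<subseteq> F" for B
      unfolding f_def[of E]
      by (subst ennreal_SUP_add_left[symmetric]) (auto intro!: SUP_least * B)
    then show ?thesis
      unfolding f_def[of F]
      by (subst ennreal_SUP_add_right) (auto intro!: SUP_least)
  qed
  have ca: "countably_additive (sets borel) f"
    unfolding countably_additive_def
  proof (intro allI impI)
    fix E :: "nat \<Rightarrow> real set"
    assume E: "range E \<subseteq> sets borel" "disjoint_family E" "(\<Union>i. E i) \<in> sets borel"
    have "f (\<Union>i. E i) \<le> (\<Sum>i. f (E i))"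
      unfolding f_def[of "\<Union>i. E i"]
    proof (rule SUP_least)
      fix A assume A: "A \<in> {A \<in> sets borel. A \<subseteq> (\<Union>i. E i)}"
      have "range (\<lambda>i. A \<inter> E i) \<subseteq> sets borel" "disjoint_family (\<lambda>i. A \<inter> E i)"
        using A E by (auto simp: disjoint_family_on_def)
      then have "(\<lambda>i. \<mu> (A \<inter> E i)) sums \<mu> (\<Union>i. A \<inter> E i)"
        using \<mu> unfolding signed_measure_def by blast
      also have "(\<Union>i. A \<inter> E i) = A" using A by auto
      finally have lim: "(\<lambda>n. ennreal (\<Sum>i<n. \<mu> (A \<inter> E i))) \<longlonglongrightarrow> ennreal (\<mu> A)"
        unfolding sums_def by (rule tendsto_ennrealI)
      have "ennreal (\<Sum>i<n. \<mu> (A \<inter> E i)) \<le> (\<Sum>i. f (E i))" for n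
      proof -
        have "ennreal (\<Sum>i<n. \<mu> (A \<inter> E i)) \<le> ennreal (\<Sum>i<n. max 0 (\<mu> (A \<inter> E i)))"
          by (intro ennreal_leI sum_mono) auto
        also have "\<dots> = (\<Sum>i<n. ennreal (max 0 (\<mu> (A \<inter> E i))))"
          by (rule sum_ennreal[symmetric]) simp
        also have "\<dots> = (\<Sum>i<n. ennreal (\<mu> (A \<inter> E i)))"
          by (intro sum.cong refl) (simp add: max_def ennreal_neg)
        also have "\<dots> \<le> (\<Sum>i<n. f (E i))"
          by (intro sum_mono le_f) (use A E in auto)
        also have "\<dots> \<le> (\<Sum>i. f (E i))"
          by (intro sum_le_suminf) auto
        finally show ?thesis .
      qed
      then show "ennreal (\<mu> A) \<le> (\<Sum>i. f (E i))"
        by (intro LIMSEQ_le_const2[OF lim] exI[of _ 0] allI impI)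
    qed
    moreover have "(\<Sum>i. f (E i)) \<le> f (\<Union>i. E i)"
    proof (rule suminf_le_const)
      fix n
      have "(\<Sum>i<n. f (E i)) \<le> f (\<Union>i<n. E i)"
      proof (induction n)
        case 0
        then show ?case by simp
      next
        case (Suc n)
        have disj: "(\<Union>i<n. E i) \<inter> E n = {}"
        proof -
          have "E i \<inter> E n = {}" if "i < n" for i
            using that by (intro disjoint_family_onD[OF E(2)]) auto
          then show ?thesis by blast
        qed
        have "(\<Sum>i<Suc n. f (E i)) \<le> f (\<Union>i<n. E i) + f (E n)"
          unfolding sum.lessThan_Suc by (rule add_right_mono) (rule Suc)
        also have "\<dots> \<le> f ((\<Union>i<n. E i) \<union> E n)"
          by (rule superadd[OF disj])
        also have "(\<Union>i<n. E i) \<union> E n = (\<Union>i<Suc n. E i)"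
          by (auto simp: lessThan_Suc)
        finally show ?case .
      qed
      also have "\<dots> \<le> f (\<Union>i. E i)" by (rule mono) auto
      finally show "(\<Sum>i<n. f (E i)) \<le> f (\<Union>i. E i)" .
    qed auto
    ultimately show "(\<Sum>i. f (E i)) = f (\<Union>i. E i)" by (rule antisym[rotated])
  qed
  have "emeasure (measure_of UNIV (sets borel) f) E = f E"
  proof (rule emeasure_measure_of_sigma)
    have "sigma_algebra (space (borel :: real measure)) (sets borel)"
      by (rule sets.sigma_algebra_axioms)
    then show "sigma_algebra (UNIV :: real set) (sets borel)" by simp
    show "positive (sets borel) f" using empty by (simp add: positive_def)
    show "countably_additive (sets borel) f" by (rule ca)
    show "E \<in> sets borel" by (rule E)
  qed
  then show ?thesis unfolding pos_part_def f_def[abs_def] .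
qed

lemma emeasure_neg_part:
  assumes "signed_measure \<mu>" "E \<in> sets borel"
  shows "emeasure (neg_part \<mu>) E = (SUP A\<in>{A \<in> sets borel. A \<subseteq> E}. ennreal (- \<mu> A))"
proof -
  have "signed_measure (\<lambda>E. - \<mu> E)"
    unfolding signed_measure_def
  proof (intro allI impI)
    fix A :: "nat \<Rightarrow> real set"
    assume "range A \<subseteq> sets borel" "disjoint_family A"
    then have "(\<lambda>i. \<mu> (A i)) sums \<mu> (\<Union>i. A i)"
      using assms(1) unfolding signed_measure_def by simp
    then show "(\<lambda>i. - \<mu> (A i)) sums - \<mu> (\<Union>i. A i)"
      by (rule sums_minus)
  qed
  then show ?thesis
    unfolding neg_part_def using assms(2) by (rule emeasure_pos_part)
qed

end

theory Submission
  imports Defs "HOL-Computational_Algebra.Fundamental_Theorem_Algebra"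
begin

text \<open>
  The norm is 1 iff no two atoms of opposite sign coincide. If two sign vectors give the same point,
  half the difference of the associated polynomials is an integer polynomial \<open>d\<close> with \<open>d(\<beta>) = 0\<close>,
  and the two signs agree iff \<open>d(1)\<close> is even. All roots of \<open>Q = x ^ m - \<dots> - x - 1\<close> other than
  the simple root \<open>\<beta>\<close> lie in the open unit disc, so a factor of \<open>Q\<close> not vanishing at \<open>\<beta>\<close>, whose
  constant coefficient is \<open>\<plusminus>1\<close>, is constant. Hence \<open>Q\<close> is the minimal polynomial of \<open>\<beta>\<close> up to sign and
  divides \<open>d\<close>; as \<open>Q(1) = 1 - m\<close> is even for odd \<open>m\<close>, so is \<open>d(1)\<close>.
\<close>

subsection \<open>Integer polynomials vanishing at a multinacci number\<close>

abbreviation ipoly :: "int poly \<Rightarrow> 'a::comm_ring_1 \<Rightarrow> 'a" where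
  "ipoly p \<equiv> poly (map_poly of_int p)"

section \<open>Integer polynomials evaluated in other rings, and minimal polynomials over the
  integers\<close>

lemma map_poly_of_int_add:
  "map_poly (of_int :: int \<Rightarrow> 'a::comm_ring_1) (p + q) = map_poly of_int p + map_poly of_int q"
  by (intro poly_eqI) (simp add: coeff_map_poly)

lemma map_poly_of_int_mult:
  "map_poly (of_int :: int \<Rightarrow> 'a::comm_ring_1) (p * q) = map_poly of_int p * map_poly of_int q"
  by (intro poly_eqI) (simp add: coeff_map_poly coeff_mult)

lemma map_poly_of_int_smult:
  "map_poly (of_int :: int \<Rightarrow> 'a::comm_ring_1) (smult c p) = smult (of_int c) (map_poly of_int p)"
  by (intro poly_eqI) (simp add: coeff_map_poly)

text \<open>Gauss's lemma: content is multiplicative, so \<open>c\<close> divides the content of the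
  cofactor and can be cancelled.\<close>

lemma primitive_dvd_smultD:
  fixes p q :: "int poly"
  assumes "content p = 1" "p dvd smult c q" "c \<noteq> 0"
  shows "p dvd q"
proof -
  obtain r where r: "smult c q = p * r" using assms(2) by (elim dvdE)
  have "normalize c * content q = content r"
    using arg_cong[OF r, of content] assms(1) by (simp add: content_mult)
  then have "c dvd content r" by (metis dvd_triv_left normalize_dvd_iff)
  then have "[:c:] dvd r" by (simp add: const_poly_dvd_iff_dvd_content)
  then obtain s where "r = [:c:] * s" by (elim dvdE)
  then have "smult c q = smult c (p * s)" using r by simp
  then have "q = p * s" by (rule smult_cancel[OF assms(3)])
  then show ?thesis by simp
qed

text \<open>The generator is the primitive part of a nonzero integer polynomial of least degree
  vanishing at \<open>z\<close>. A pseudo-remainder modulo it vanishes at \<open>z\<close> and has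
  smaller degree, hence is zero.\<close>

lemma exists_int_minpoly:
  fixes z :: complex
  assumes "q \<noteq> 0" "ipoly q z = 0"
  obtains p where "ipoly p z = 0" "\<And>f. ipoly f z = 0 \<Longrightarrow> p dvd f"
proof -
  define P where "P p \<longleftrightarrow> p \<noteq> 0 \<and> ipoly p z = 0" for p
  obtain p0 where p0: "P p0" and min: "\<And>f. P f \<Longrightarrow> degree p0 \<le> degree f"
    using ex_has_least_nat[of P q degree] assms unfolding P_def by blast
  define p where "p = primitive_part p0"
  have p0_eq: "p0 = smult (content p0) p" by (simp add: p_def)
  have p: "p \<noteq> 0" "content p = 1" "degree p = degree p0"
    using p0 by (auto simp: p_def P_def)
  have "of_int (content p0) * ipoly p z = 0"
    using p0 arg_cong[OF p0_eq, of "\<lambda>f. ipoly f z"]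
    by (auto simp: P_def map_poly_of_int_smult simp del: content_times_primitive_part)
  then have pz: "ipoly p z = 0" using p0 by (simp add: P_def)
  have "p dvd f" if f: "ipoly f z = 0" for f
  proof -
    \<comment> \<open>Division over the integers requires scaling \<open>f\<close> by
      \<open>a\<close>; primitivity of \<open>p\<close> removes this factor at the end.\<close>
    obtain a s where a: "a \<noteq> 0" "smult a f = p * s + pseudo_mod f p"
      using pseudo_mod(1)[OF p(1)] by blast
    have "ipoly (smult a f) z = ipoly (p * s + pseudo_mod f p) z" by (simp only: a)
    then have "ipoly (pseudo_mod f p) z = 0"
      using f pz by (simp add: map_poly_of_int_add map_poly_of_int_mult map_poly_of_int_smult)
    then have "pseudo_mod f p = 0"
      using pseudo_mod(2)[OF p(1), of f] min[of "pseudo_mod f p"] p(3)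
      unfolding P_def by (metis not_le)
    then have "p dvd smult a f" using a by simp
    then show ?thesis using primitive_dvd_smultD p(2) a(1) by blast
  qed
  then show ?thesis using pz that by blast
qed

text \<open>Up to sign, the constant coefficient is the leading one times the product of all roots.
  This excludes a nonconstant integer factor with both coefficients equal to 1 or -1 and all roots
  in the open unit disc.\<close>

lemma norm_poly_0_less_lead_coeff:
  fixes p :: "complex poly"
  assumes "degree p > 0" "\<And>z. poly p z = 0 \<Longrightarrow> norm z < 1"
  shows "norm (poly p 0) < norm (lead_coeff p)"
proof -
  obtain root where root: "smult (lead_coeff p) (\<Prod>i<degree p. [:- root i, 1:]) = p"
    by (rule complex_poly_decompose')
  have eval: "poly p z = lead_coeff p * (\<Prod>i<degree p. z - root i)" for z
    by (subst root[symmetric]) (simp add: poly_prod)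
  have small: "norm (root i) < 1" if "i < degree p" for i
    by (rule assms(2)) (use that in \<open>auto simp: eval prod_zero_iff\<close>)
  have "(\<Prod>i<degree p. norm (root i)) < (\<Prod>i<degree p. 1)"
    by (rule prod_mono_strict[of 0]) (use small assms(1) in \<open>auto intro: less_imp_le\<close>)
  moreover have "p \<noteq> 0" using assms(1) by auto
  ultimately show ?thesis
    using assms(1)
    by (subst eval) (auto simp: norm_mult prod_norm[symmetric] mult_less_cancel_left1)
qed

section \<open>Location and simplicity of the roots of the multinacci polynomial\<close>

definition multinacci_poly :: "nat \<Rightarrow> int poly" where
  "multinacci_poly m = monom 1 m - (\<Sum>k<m. monom 1 k)"

lemma ipoly_multinacci_poly: "ipoly (multinacci_poly m) z = z ^ m - (\<Sum>k<m. z ^ k)"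
proof -
  have "map_poly of_int (multinacci_poly m) = monom (1::'a) m - (\<Sum>k<m. monom 1 k)"
    by (intro poly_eqI) (simp add: coeff_map_poly multinacci_poly_def coeff_sum)
  then show ?thesis by (simp add: poly_monom poly_sum)
qed

text \<open>Multiplying the equation by \<open>z - 1\<close> collapses the geometric sum.\<close>

lemma multinacci_root_mult:
  fixes z :: "'a::comm_ring_1"
  assumes "z ^ m = (\<Sum>k<m. z ^ k)"
  shows "z ^ m * (2 - z) = 1"
proof -
  have "(z - 1) * z ^ m = z ^ m - 1"
    using power_diff_1_eq[of z m] assms by (metis)
  then show ?thesis by (simp add: algebra_simps)
qed

text \<open>Division by \<open>x ^ m\<close> turns the equation into
  \<open>1 = 1/x + ... + 1/x ^ m\<close>, whose right side is strictly decreasing for positive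
  \<open>x\<close>.\<close>

lemma multinacci_root_real_unique:
  fixes x y :: real
  assumes "0 < x" "x < y" "m > 0" "x ^ m = (\<Sum>k<m. x ^ k)"
  shows "y ^ m \<noteq> (\<Sum>k<m. y ^ k)"
proof -
  have split: "z ^ m * inverse z ^ (m - k) = z ^ k" if "k < m" "z > 0" for k and z :: real
    using that power_add[of z k "m - k"] by (simp add: field_simps)
  have "(\<Sum>k<m. inverse y ^ (m - k)) < (\<Sum>k<m. inverse x ^ (m - k))"
    using assms by (intro sum_strict_mono power_strict_mono) auto
  moreover have "x ^ m * (\<Sum>k<m. inverse x ^ (m - k)) = x ^ m"
    using assms(1) by (simp add: sum_distrib_left split assms(4)[symmetric])
  then have "(\<Sum>k<m. inverse x ^ (m - k)) = 1" using assms(1) by simp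
  ultimately have "y ^ m * (\<Sum>k<m. inverse y ^ (m - k)) < y ^ m * 1"
    using assms by (intro mult_strict_left_mono) auto
  then show ?thesis using assms by (simp add: sum_distrib_left split)
qed

text \<open>If \<open>norm z\<close> is at least 1, the triangle inequality for the equation and the
  identity \<open>z ^ m * (2 - z) = 1\<close> force \<open>norm (2 - z) = 2 - norm z\<close>. This
  equality case makes \<open>z\<close> a positive real root, which is unique.\<close>

lemma multinacci_root_complex:
  fixes z :: complex
  assumes "m \<ge> 2" and z: "z ^ m = (\<Sum>k<m. z ^ k)"
    and \<beta>: "\<beta> > 0" "\<beta> ^ m = (\<Sum>k<m. \<beta> ^ k)"
  shows "z = of_real \<beta> \<or> norm z < 1"
proof (rule disjCI)
  assume "\<not> norm z < 1"
  define r where "r = norm z"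
  have r: "r \<ge> 1" using \<open>\<not> norm z < 1\<close> by (simp add: r_def)
  have "r ^ m \<le> (\<Sum>k<m. r ^ k)"
    unfolding r_def norm_power[symmetric] by (subst z) (rule norm_sum)
  then have "(r - 1) * r ^ m \<le> r ^ m - 1"
    using r by (subst power_diff_1_eq) (intro mult_left_mono, auto)
  then have lower: "r ^ m * (2 - r) \<ge> 1" by (simp add: algebra_simps)
  have upper: "r ^ m * norm (2 - z) = 1"
    using arg_cong[OF multinacci_root_mult[OF z], of norm] by (simp add: norm_mult norm_power r_def)
  have "r ^ m * norm (2 - z) \<le> r ^ m * (2 - r)" using lower upper by simp
  then have "norm (2 - z) \<le> 2 - r" using r by (simp add: mult_le_cancel_left)
  moreover have "2 - r \<le> norm (2 - z)"
    using norm_triangle_ineq2[of 2 z] by (simp add: r_def)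
  \<comment> \<open>Expanding both squares, the terms 4 and \<open>r ^ 2\<close> cancel and only
    \<open>4 * Re z = 4 * r\<close> remains.\<close>
  ultimately have "(norm (2 - z))\<^sup>2 = (2 - r)\<^sup>2" by simp
  then have "Re z = r"
    unfolding r_def cmod_power2 power2_diff by (simp add: power2_eq_square algebra_simps)
  then have zr: "z = of_real r"
    using cmod_power2[of z] by (simp add: r_def complex_eq_iff)
  have "complex_of_real (r ^ m) = of_real (\<Sum>k<m. r ^ k)"
    using z zr by simp
  then have "r ^ m = (\<Sum>k<m. r ^ k)" by (simp only: of_real_eq_iff)
  then have "r = \<beta>"
    using multinacci_root_real_unique[of r \<beta> m] multinacci_root_real_unique[of \<beta> r m] \<beta> r assms(1)
    by (cases r \<beta> rule: linorder_cases) auto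
  then show "z = of_real \<beta>" using zr by simp
qed

text \<open>A common zero of \<open>p\<close> and \<open>q\<close> would be a double root of the
  product, hence a zero of the derivative of its multiple by \<open>x - 1\<close>, which is a
  trinomial.\<close>

lemma multinacci_root_simple:
  fixes \<beta> :: real and p q :: "complex poly"
  assumes m: "m \<ge> 2" and \<beta>: "\<beta> > 1" "\<beta> ^ m = (\<Sum>k<m. \<beta> ^ k)"
    and pq: "p * q = map_poly of_int (multinacci_poly m)" and "poly p (of_real \<beta>) = 0"
  shows "poly q (of_real \<beta>) \<noteq> 0"
proof
  assume "poly q (of_real \<beta>) = 0"
  \<comment> \<open>This is \<open>x - 1\<close> times the multinacci polynomial.\<close>
  define S :: "complex poly" where "S = monom 1 (Suc m) - monom 2 m + 1"
  have "poly S z = poly ([:-1, 1:] * (p * q)) z" for z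
    using power_diff_1_eq[of z m]
    by (simp add: S_def pq ipoly_multinacci_poly poly_monom algebra_simps)
  then have S: "S = [:-1, 1:] * (p * q)" using poly_eq_poly_eq_iff by blast
  have "poly (pderiv S) (of_real \<beta>) = 0"
    unfolding S pderiv_mult[of _ "p * q"] pderiv_mult[of p q]
    using \<open>poly p _ = 0\<close> \<open>poly q _ = 0\<close> by simp
  then have "of_real (real (Suc m) * \<beta> ^ m - 2 * real m * \<beta> ^ (m - 1)) = (0 :: complex)"
    by (simp add: S_def pderiv_add pderiv_diff pderiv_monom poly_monom algebra_simps)
  then have "real (Suc m) * \<beta> ^ m = 2 * real m * \<beta> ^ (m - 1)" unfolding of_real_eq_0_iff by simp
  also have "\<beta> ^ m = \<beta> * \<beta> ^ (m - 1)" using m by (cases m) auto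
  finally have eq: "real (Suc m) * \<beta> = 2 * real m" using \<beta>(1) by simp
  \<comment> \<open>Inserting \<open>eq\<close> into \<open>\<beta> ^ m * (2 - \<beta>) = 1\<close>
    gives \<open>m + 1 = 2 * \<beta> ^ m\<close>, which is at least \<open>2 * m\<close>: impossible
    for \<open>m\<close> at least 2.\<close>
  have "real (Suc m) = real (Suc m) * (\<beta> ^ m * (2 - \<beta>))" using multinacci_root_mult[OF \<beta>(2)] by simp
  also have "\<dots> = \<beta> ^ m * (2 * real (Suc m) - real (Suc m) * \<beta>)" by (simp add: algebra_simps)
  also have "\<dots> = 2 * \<beta> ^ m" unfolding eq by simp
  finally have "real (Suc m) = 2 * \<beta> ^ m" .
  moreover have "(\<Sum>k<m. 1) \<le> (\<Sum>k<m. \<beta> ^ k)" using \<beta>(1) by (intro sum_mono one_le_power) auto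
  then have "real m \<le> \<beta> ^ m" using \<beta>(2) by simp
  ultimately show False using m by simp
qed

text \<open>The minimal polynomial \<open>p\<close> divides both \<open>Q\<close> and
  \<open>f\<close>. The cofactor of \<open>p\<close> in \<open>Q\<close> is the constant 1 or -1, so
  \<open>p\<close> inherits an even value at 1 from \<open>Q\<close> and passes it on to
  \<open>f\<close>.\<close>

lemma even_poly_1_if_multinacci_root:
  fixes \<beta> :: real
  assumes m: "m \<ge> 2" "odd m" and \<beta>: "\<beta> > 1" "\<beta> ^ m = (\<Sum>k<m. \<beta> ^ k)"
    and f: "ipoly f \<beta> = 0"
  shows "even (poly f 1)"
proof -
  define Q where "Q = multinacci_poly m"
  define b where "b = complex_of_real \<beta>"
  have of_real: "ipoly g b = of_real (ipoly g \<beta>)" for g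
    by (simp add: b_def poly_altdef coeff_map_poly degree_map_poly)
  have Qb: "ipoly Q b = 0" unfolding of_real by (simp add: Q_def ipoly_multinacci_poly \<beta>)
  have lead: "coeff Q m = 1" and Q0: "poly Q 0 = -1"
    using m by (simp_all add: Q_def multinacci_poly_def coeff_sum poly_sum poly_monom power_0_left)
  have "degree Q \<le> m"
    unfolding Q_def multinacci_poly_def by (intro degree_diff_le degree_sum_le) (auto intro: degree_monom_le order.trans[OF degree_monom_le])
  then have "lead_coeff Q = 1"
    using lead le_degree[of Q m] by (metis le_antisym zero_neq_one)
  have "Q \<noteq> 0" using lead by auto
  obtain p where p: "ipoly p b = 0" "\<And>f. ipoly f b = 0 \<Longrightarrow> p dvd f"
    using exists_int_minpoly[OF \<open>Q \<noteq> 0\<close> Qb] by blast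
  obtain h where h: "Q = p * h" using p(2)[OF Qb] by (elim dvdE)
  \<comment> \<open>\<open>Q\<close> is monic with constant coefficient -1, and integer factors of a
    unit are units.\<close>
  have lead_h: "\<bar>lead_coeff h\<bar> = 1"
    using \<open>lead_coeff Q = 1\<close> unfolding h lead_coeff_mult by (metis abs_zmult_eq_1 abs_1 mult.commute)
  have h0: "\<bar>poly h 0\<bar> = 1"
    using Q0 unfolding h poly_mult by (metis abs_zmult_eq_1 abs_1 abs_minus mult.commute)
  have "degree h = 0"
  proof (rule ccontr)
    assume "degree h \<noteq> 0"
    \<comment> \<open>A root of \<open>h\<close> is a root of \<open>Q\<close>. It differs from
      \<open>\<beta>\<close>, where \<open>p\<close> already accounts for the simple zero.\<close>
    moreover have "norm z < 1" if hz: "ipoly h z = 0" for z :: complex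
    proof -
      have pq: "map_poly of_int p * map_poly of_int h = (map_poly of_int (multinacci_poly m) :: complex poly)"
        unfolding Q_def[symmetric] h map_poly_of_int_mult ..
      have "z ^ m = (\<Sum>k<m. z ^ k)"
        using arg_cong[OF pq, of "\<lambda>f. poly f z"] hz by (simp add: ipoly_multinacci_poly)
      moreover have "z \<noteq> of_real \<beta>"
        using multinacci_root_simple[OF m(1) \<beta> pq] p(1) hz by (auto simp: b_def)
      moreover have "\<beta> > 0" using \<beta>(1) by simp
      ultimately show ?thesis using multinacci_root_complex[OF m(1) _ _ \<beta>(2)] by blast
    qed
    ultimately have "norm (ipoly h (0 :: complex)) < norm (lead_coeff (map_poly of_int h :: complex poly))"
      by (intro norm_poly_0_less_lead_coeff) (auto simp: degree_map_poly)
    also have "ipoly h (0 :: complex) = of_int (poly h 0)" by (simp add: poly_0_coeff_0 coeff_map_poly)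
    finally have "norm (of_int (poly h 0) :: complex) < norm (of_int (lead_coeff h) :: complex)"
      by (simp add: degree_map_poly coeff_map_poly)
    then have "\<bar>poly h 0\<bar> < \<bar>lead_coeff h\<bar>" by (simp only: norm_of_int of_int_less_iff flip: of_int_abs)
    then show False using h0 lead_h by simp
  qed
  then have "poly h 1 = lead_coeff h" by (elim degree_eq_zeroE) simp
  then have h1: "odd (poly h 1)" using lead_h by presburger
  have "poly Q 1 = 1 - int m" by (simp add: Q_def multinacci_poly_def poly_sum poly_monom)
  then have "even (poly Q 1)" using m(2) by simp
  then have "even (poly p 1)" using h1 unfolding h by simp
  moreover have "p dvd f" using f by (intro p(2)) (simp add: of_real)
  ultimately show ?thesis by (metis dvdE dvd_mult2 poly_mult)
qed

section \<open>Sign lists and the parity argument\<close>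

definition sign_lists :: "nat \<Rightarrow> int list set" where
  "sign_lists n = {l. set l \<subseteq> {-1, 1} \<and> length l = n}"

lemma prod_list_sign_list:
  assumes "set l \<subseteq> {-1, 1 :: int}"
  shows "prod_list l \<in> {-1, 1}"
  using assms by (induction l) auto

text \<open>With \<open>k\<close> entries equal to -1, the sum minus the length is
  \<open>-2 * k\<close>, and \<open>(-1) ^ k - 1\<close> is congruent to this modulo 4.\<close>

lemma prod_list_sign_list_cong:
  assumes "set l \<subseteq> {-1, 1 :: int}"
  shows "4 dvd sum_list l - int (length l) - (prod_list l - 1)"
  using assms
proof (induction l)
  case (Cons e l)
  then have "prod_list l \<in> {-1, 1}" using prod_list_sign_list by simp
  moreover have "e \<in> {-1, 1}" using Cons.prems by simp
  moreover have "4 dvd sum_list l - int (length l) - (prod_list l - 1)" using Cons by simp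
  ultimately show ?case by (elim insertE emptyE; simp; presburger)
qed simp

lemma Poly_diff_sign_lists:
  assumes "length l = length l'" "set l \<subseteq> {-1, 1 :: int}" "set l' \<subseteq> {-1, 1}"
  shows "\<exists>d. Poly l - Poly l' = smult 2 d"
  using assms
proof (induction l l' rule: list_induct2)
  case (Cons e l e' l')
  then obtain d where d: "Poly l - Poly l' = smult 2 d" by auto
  have "e - e' = 2 * ((e - e') div 2)" using Cons.prems by auto
  then have "Poly (e # l) - Poly (e' # l') = smult 2 (pCons ((e - e') div 2) d)"
    using d by simp
  then show ?case ..
qed (auto intro: exI[of _ 0])

lemma poly_Poly_1: "poly (Poly l) 1 = sum_list (l :: int list)"
  by (induction l) auto

text \<open>Half the difference of the polynomials vanishes at \<open>\<beta>\<close>, so its value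
  at 1 is even and the two sums agree modulo 4. Then so do the products, and 1 and -1 differ modulo
  4.\<close>

lemma prod_list_eq_if_multinacci_values_eq:
  fixes \<beta> :: real
  assumes m: "m \<ge> 2" "odd m" and \<beta>: "\<beta> > 1" "\<beta> ^ m = (\<Sum>k<m. \<beta> ^ k)"
    and l: "l \<in> sign_lists n" "l' \<in> sign_lists n" and eq: "ipoly (Poly l) \<beta> = ipoly (Poly l') \<beta>"
  shows "prod_list l = prod_list l'"
proof -
  have len: "length l = length l'" and set: "set l \<subseteq> {-1, 1}" "set l' \<subseteq> {-1, 1}"
    using l by (auto simp: sign_lists_def)
  obtain d where d: "Poly l - Poly l' = smult 2 d"
    using Poly_diff_sign_lists[OF len set] ..
  then have "Poly l = Poly l' + smult 2 d" by (simp add: algebra_simps)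
  then have "ipoly d \<beta> = 0"
    using eq by (simp add: map_poly_of_int_add map_poly_of_int_smult)
  then have "even (poly d 1)" using even_poly_1_if_multinacci_root m \<beta> by blast
  moreover have "sum_list l - sum_list l' = 2 * poly d 1"
    using arg_cong[OF d, of "\<lambda>f. poly f 1"] by (simp add: poly_Poly_1)
  ultimately have "4 dvd sum_list l - sum_list l'" by presburger
  then have "4 dvd prod_list l - prod_list l'"
    using prod_list_sign_list_cong[OF set(1)] prod_list_sign_list_cong[OF set(2)] len by presburger
  moreover have "prod_list l \<in> {-1, 1}" "prod_list l' \<in> {-1, 1}"
    using set by (auto dest: prod_list_sign_list)
  ultimately show ?thesis by auto
qed

subsection \<open>Finitely supported signed measures\<close>

text \<open>The points need not be distinct: indices with the same point remain separate terms, so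
  sign lists can serve as indices without merging atoms.\<close>

definition atomic :: "'i set \<Rightarrow> ('i \<Rightarrow> real) \<Rightarrow> ('i \<Rightarrow> real) \<Rightarrow> real set \<Rightarrow> real" where
  "atomic I c x E = (\<Sum>i\<in>I. c i * indicator E (x i))"

text \<open>Under this condition the Jordan parts and the norm can be read off term by term from the
  coefficients.\<close>

definition noncancelling :: "'i set \<Rightarrow> ('i \<Rightarrow> real) \<Rightarrow> ('i \<Rightarrow> real) \<Rightarrow> bool" where
  "noncancelling I c x \<longleftrightarrow> (\<forall>i\<in>I. \<forall>j\<in>I. x i = x j \<longrightarrow> 0 \<le> c i * c j)"

text \<open>Negative coefficients are cut off to 0 by \<open>ennreal\<close>.\<close>

definition atoms :: "'i set \<Rightarrow> ('i \<Rightarrow> real) \<Rightarrow> ('i \<Rightarrow> real) \<Rightarrow> real measure" where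
  "atoms I c x = distr (point_measure I (\<lambda>i. ennreal (c i))) borel x"

lemma sets_atoms [simp, measurable_cong]: "sets (atoms I c x) = sets borel"
  by (simp add: atoms_def)

lemma nn_integral_atoms:
  assumes "finite I" "f \<in> borel_measurable borel"
  shows "(\<integral>\<^sup>+t. f t \<partial>atoms I c x) = (\<Sum>i\<in>I. ennreal (c i) * f (x i))"
  using assms by (simp add: atoms_def nn_integral_distr nn_integral_point_measure_finite)

lemma emeasure_atoms:
  assumes "finite I" "E \<in> sets borel"
  shows "emeasure (atoms I c x) E = (\<Sum>i\<in>I. ennreal (c i) * indicator E (x i))"
  using nn_integral_atoms[of I "indicator E" c x] assms by simp

lemma finite_measure_atoms: "finite I \<Longrightarrow> finite_measure (atoms I c x)"
  using sets_eq_imp_space_eq[OF sets_atoms, of I c x]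
  by (intro finite_measureI) (simp add: emeasure_atoms)

lemma measure_convolution_atoms:
  assumes "finite I" "finite J" "E \<in> sets borel"
  shows "measure (atoms I c x \<star> atoms J d y) E =
    (\<Sum>i\<in>I. \<Sum>j\<in>J. max 0 (c i) * max 0 (d j) * indicator E (x i + y j))"
proof -
  note assms(3) [measurable]
  have "emeasure (atoms I c x \<star> atoms J d y) E =
      (\<integral>\<^sup>+s. \<integral>\<^sup>+t. indicator E (s + t) \<partial>atoms J d y \<partial>atoms I c x)"
    using assms by (intro convolution_emeasure' finite_measure_atoms) auto
  also have "\<dots> = (\<integral>\<^sup>+s. (\<Sum>j\<in>J. ennreal (d j) * indicator E (s + y j)) \<partial>atoms I c x)"
    using assms by (simp add: nn_integral_atoms)
  also have "\<dots> = (\<Sum>i\<in>I. ennreal (c i) * (\<Sum>j\<in>J. ennreal (d j) * indicator E (x i + y j)))"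
    by (subst nn_integral_atoms[OF assms(1)], measurable)
  also have "\<dots> = (\<Sum>i\<in>I. \<Sum>j\<in>J. ennreal (max 0 (c i) * max 0 (d j) * indicator E (x i + y j)))"
    unfolding sum_distrib_left
    by (intro sum.cong refl) (auto simp: ennreal_mult ennreal_max_0 mult.assoc split: split_indicator)
  also have "\<dots> = ennreal (\<Sum>i\<in>I. \<Sum>j\<in>J. max 0 (c i) * max 0 (d j) * indicator E (x i + y j))"
    by (simp add: sum_nonneg)
  finally show ?thesis
    by (simp add: measure_def sum_nonneg)
qed

section \<open>Jordan parts, convolution and norm of atomic signed measures\<close>

lemma signed_measure_atomic:
  assumes "\<And>E. E \<in> sets borel \<Longrightarrow> \<mu> E = atomic I c x E"
  shows "signed_measure \<mu>"
  unfolding signed_measure_def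
proof (intro allI impI)
  fix A :: "nat \<Rightarrow> real set"
  assume A: "range A \<subseteq> sets borel" "disjoint_family A"
  have "(\<lambda>k. atomic I c x (A k)) sums atomic I c x (\<Union>k. A k)"
    unfolding atomic_def
    by (intro sums_sum sums_mult indicator_sums) (use A(2) in \<open>auto simp: disjoint_family_on_def\<close>)
  then show "(\<lambda>k. \<mu> (A k)) sums \<mu> (\<Union>k. A k)"
    using A(1) by (simp add: assms subset_eq)
qed

text \<open>The supremum over Borel subsets of \<open>E\<close> is attained at the finite set of
  points in \<open>E\<close> with a positive coefficient; no negative coefficient sits at such a
  point.\<close>

lemma pos_part_atomic:
  assumes fin: "finite I" and \<mu>: "\<And>E. E \<in> sets borel \<Longrightarrow> \<mu> E = atomic I c x E"
    and nc: "noncancelling I c x"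
  shows "pos_part \<mu> = atoms I c x"
proof (rule measure_eqI)
  show "sets (pos_part \<mu>) = sets (atoms I c x)"
    using sets.sigma_sets_eq[of "borel :: real measure"] by (simp add: pos_part_def)
  fix E assume "E \<in> sets (pos_part \<mu>)"
  then have E: "E \<in> sets borel"
    using sets.sigma_sets_eq[of "borel :: real measure"] by (simp add: pos_part_def)
  define A where "A = E \<inter> x ` {i \<in> I. c i > 0}"
  have A: "A \<in> sets borel" "A \<subseteq> E" using E fin by (auto simp: A_def intro!: borel_closed finite_imp_closed)
  have em: "emeasure (atoms I c x) E = ennreal (\<Sum>i\<in>I. max 0 (c i) * indicator E (x i))"
  proof -
    have "emeasure (atoms I c x) E = (\<Sum>i\<in>I. ennreal (max 0 (c i) * indicator E (x i)))"
      unfolding emeasure_atoms[OF fin E]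
      by (intro sum.cong refl) (auto simp: ennreal_max_0 split: split_indicator)
    then show ?thesis by simp
  qed
  have "\<mu> A = (\<Sum>i\<in>I. max 0 (c i) * indicator E (x i))"
    unfolding \<mu>[OF A(1)] atomic_def
  proof (rule sum.cong[OF refl])
    fix i assume i: "i \<in> I"
    have "c i = 0" if ci: "c i \<le> 0" "x i \<in> A"
    proof -
      obtain j where "j \<in> I" "c j > 0" "x i = x j" using ci(2) by (auto simp: A_def)
      then have "0 \<le> c i * c j" using nc i by (auto simp: noncancelling_def)
      then show ?thesis using \<open>c j > 0\<close> ci(1) by (simp add: zero_le_mult_iff)
    qed
    then show "c i * indicator A (x i) = max 0 (c i) * indicator E (x i)"
      using i by (cases "c i > 0") (auto simp: A_def max_def split: split_indicator)
  qed
  moreover have "ennreal (\<mu> B) \<le> ennreal (\<Sum>i\<in>I. max 0 (c i) * indicator E (x i))"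
    if "B \<in> sets borel" "B \<subseteq> E" for B
    unfolding \<mu>[OF that(1)] atomic_def
    by (intro ennreal_leI sum_mono) (use that in \<open>auto split: split_indicator\<close>)
  ultimately have "(SUP B\<in>{B \<in> sets borel. B \<subseteq> E}. ennreal (\<mu> B)) = emeasure (atoms I c x) E"
    unfolding em using A by (intro antisym SUP_least) (auto intro!: SUP_upper2[of A])
  then show "emeasure (pos_part \<mu>) E = emeasure (atoms I c x) E"
    using emeasure_pos_part[OF signed_measure_atomic[OF \<mu>] E] by simp
qed

lemma neg_part_atomic:
  assumes "finite I" and "\<And>E. E \<in> sets borel \<Longrightarrow> \<mu> E = atomic I c x E"
    and "noncancelling I c x"
  shows "neg_part \<mu> = atoms I (\<lambda>i. - c i) x"
  unfolding neg_part_def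
  using assms by (intro pos_part_atomic) (auto simp: atomic_def noncancelling_def sum_negf)

text \<open>Each coefficient is its positive part minus its negative part, so the four convolutions
  of Jordan parts recombine to the product of the coefficients.\<close>

lemma signed_conv_atomic:
  assumes "finite I" "\<And>E. E \<in> sets borel \<Longrightarrow> \<mu> E = atomic I c x E" "noncancelling I c x"
    and "finite J" "\<And>E. E \<in> sets borel \<Longrightarrow> \<nu> E = atomic J d y E" "noncancelling J d y"
    and E: "E \<in> sets borel"
  shows "signed_conv \<mu> \<nu> E = atomic (I \<times> J) (\<lambda>(i, j). c i * d j) (\<lambda>(i, j). x i + y j) E"
proof -
  have *: "max 0 a * max 0 b * t - max 0 a * max 0 (- b) * t - max 0 (- a) * max 0 b * t
      + max 0 (- a) * max 0 (- b) * t = a * b * t" for a b t :: real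
    by (auto simp: max_def)
  have parts: "pos_part \<mu> = atoms I c x" "neg_part \<mu> = atoms I (\<lambda>i. - c i) x"
    "pos_part \<nu> = atoms J d y" "neg_part \<nu> = atoms J (\<lambda>j. - d j) y"
    using assms by (auto intro: pos_part_atomic neg_part_atomic)
  show ?thesis
    unfolding signed_conv_def parts
      measure_convolution_atoms[OF assms(1,4) E] sum_subtractf[symmetric] sum.distrib[symmetric] *
    by (simp add: atomic_def sum.cartesian_product case_prod_unfold)
qed

text \<open>The upper bound is the triangle inequality on each piece of a partition; the lower bound
  uses a Hahn decomposition.\<close>

lemma tv_norm_atomic:
  assumes fin: "finite I" and \<mu>: "\<And>E. E \<in> sets borel \<Longrightarrow> \<mu> E = atomic I c x E"
    and nc: "noncancelling I c x"
  shows "tv_norm \<mu> = ennreal (\<Sum>i\<in>I. \<bar>c i\<bar>)"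
  unfolding tv_norm_def
proof (intro antisym SUP_least)
  fix A :: "nat \<Rightarrow> real set"
  assume "A \<in> {A. range A \<subseteq> sets borel \<and> disjoint_family A \<and> (\<Union>i. A i) = UNIV}"
  then have A: "\<And>k. A k \<in> sets borel" "disjoint_family A" "(\<Union>k. A k) = UNIV" by auto
  have "(\<lambda>k. \<Sum>i\<in>I. \<bar>c i\<bar> * indicator (A k) (x i)) sums (\<Sum>i\<in>I. \<bar>c i\<bar> * indicator (\<Union>k. A k) (x i))"
    by (intro sums_sum sums_mult indicator_sums) (use A(2) in \<open>auto simp: disjoint_family_on_def\<close>)
  then have "(\<lambda>k. \<Sum>i\<in>I. \<bar>c i\<bar> * indicator (A k) (x i)) sums (\<Sum>i\<in>I. \<bar>c i\<bar>)"
    by (simp add: A(3))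
  then have "(\<Sum>k. ennreal (\<Sum>i\<in>I. \<bar>c i\<bar> * indicator (A k) (x i))) = ennreal (\<Sum>i\<in>I. \<bar>c i\<bar>)"
    by (intro suminf_ennreal_eq sum_nonneg) auto
  moreover have "\<bar>\<mu> (A k)\<bar> \<le> (\<Sum>i\<in>I. \<bar>c i\<bar> * indicator (A k) (x i))" for k
    unfolding \<mu>[OF A(1)] atomic_def
    by (rule order.trans[OF sum_abs]) (simp add: abs_mult)
  then have "(\<Sum>k. ennreal \<bar>\<mu> (A k)\<bar>) \<le> (\<Sum>k. ennreal (\<Sum>i\<in>I. \<bar>c i\<bar> * indicator (A k) (x i)))"
    by (intro suminf_le ennreal_leI) auto
  ultimately show "(\<Sum>k. ennreal \<bar>\<mu> (A k)\<bar>) \<le> ennreal (\<Sum>i\<in>I. \<bar>c i\<bar>)" by simp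
next
  \<comment> \<open>The positive set of the Hahn decomposition; coefficients at its points are
    nonnegative, all others nonpositive.\<close>
  define P where "P = x ` {i \<in> I. c i > 0}"
  have "closed P" using fin by (simp add: P_def finite_imp_closed)
  then have P: "P \<in> sets borel" "- P \<in> sets borel" by (simp_all add: open_Compl)
  have sgn: "c i \<ge> 0" if i: "i \<in> I" "x i \<in> P" for i
  proof -
    obtain j where "j \<in> I" "c j > 0" "x i = x j" using i(2) by (auto simp: P_def)
    then have "0 \<le> c i * c j" using nc i by (auto simp: noncancelling_def)
    then show ?thesis using \<open>c j > 0\<close> by (simp add: zero_le_mult_iff)
  qed
  have sgn': "c i \<le> 0" if "i \<in> I" "x i \<notin> P" for i
    using that by (force simp: P_def not_less)
  have "(\<Sum>i\<in>I. \<bar>c i\<bar>) = \<mu> P - \<mu> (- P)"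
    unfolding \<mu>[OF P(1)] \<mu>[OF P(2)] atomic_def sum_subtractf[symmetric]
    by (intro sum.cong refl) (auto dest: sgn sgn' split: split_indicator)
  also have "\<dots> \<le> \<bar>\<mu> P\<bar> + \<bar>\<mu> (- P)\<bar>" by simp
  finally have "ennreal (\<Sum>i\<in>I. \<bar>c i\<bar>) \<le> ennreal \<bar>\<mu> P\<bar> + ennreal \<bar>\<mu> (- P)\<bar>"
    by (simp add: ennreal_plus[symmetric] del: ennreal_plus)
  \<comment> \<open>The two-set partition is padded to a sequence by empty sets, where the measure
    is 0.\<close>
  also have "\<dots> = (\<Sum>k. ennreal \<bar>\<mu> (binaryset P (- P) k)\<bar>)"
    by (subst suminf_binaryset_eq) (simp_all add: \<mu> atomic_def)
  also have "\<dots> \<le> (SUP A\<in>{A :: nat \<Rightarrow> real set. range A \<subseteq> sets borel \<and> disjoint_family A \<and> (\<Union>i. A i) = UNIV}.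
        \<Sum>k. ennreal \<bar>\<mu> (A k)\<bar>)"
    by (rule SUP_upper)
       (use P in \<open>auto simp: range_binaryset_eq UN_binaryset_eq disjoint_family_on_def binaryset_def\<close>)
  finally show "ennreal (\<Sum>i\<in>I. \<bar>c i\<bar>) \<le> \<dots>" .
qed

subsection \<open>Signed Bernoulli convolutions\<close>

lemma finite_sign_lists: "finite (sign_lists n)"
  unfolding sign_lists_def by (rule finite_lists_length_eq) simp

lemma card_sign_lists: "card (sign_lists n) = 2 ^ n"
  unfolding sign_lists_def by (subst card_lists_length_eq) (auto simp: card_insert_if numeral_2_eq_2)

lemma sign_lists_Suc: "sign_lists (Suc n) = (\<lambda>(l, e). e # l) ` (sign_lists n \<times> {-1, 1})"
  unfolding sign_lists_def by (rule lists_length_Suc_eq)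

definition bernoulli_weight :: "nat \<Rightarrow> int list \<Rightarrow> real" where
  "bernoulli_weight n l = of_int (prod_list l) / 2 ^ n"

text \<open>The signs are listed in reverse, so that \<open>\<beta> ^ n\<close> times \<open>\<Sum>j. \<epsilon> j / \<beta> ^ j\<close> is a polynomial in \<open>\<beta>\<close>
  whose constant coefficient is the head of the list.\<close>

definition bernoulli_point :: "real \<Rightarrow> nat \<Rightarrow> int list \<Rightarrow> real" where
  "bernoulli_point \<beta> n l = ipoly (Poly l) \<beta> / \<beta> ^ n"

text \<open>Prepending a sign \<open>e\<close> sends the polynomial value \<open>v\<close> to
  \<open>e + \<beta> * v\<close>, so after normalization the point moves by
  \<open>e / \<beta> ^ Suc n\<close>. Each convolution step goes through Jordan parts, which is
  where \<open>nc\<close> enters.\<close>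

lemma signed_bernoulli_atomic:
  assumes \<beta>: "\<beta> > 0"
    and nc: "\<And>n. noncancelling (sign_lists n) (bernoulli_weight n) (bernoulli_point \<beta> n)"
    and E: "E \<in> sets borel"
  shows "signed_bernoulli \<beta> n E = atomic (sign_lists n) (bernoulli_weight n) (bernoulli_point \<beta> n) E"
  using E
proof (induction n arbitrary: E)
  case 0
  have "sign_lists 0 = {[]}" by (auto simp: sign_lists_def)
  with 0 show ?case
    by (simp add: dirac_def measure_return atomic_def bernoulli_weight_def bernoulli_point_def)
next
  case (Suc n)
  define b where "b = 1 / \<beta> ^ Suc n"
  have b: "b > 0" using \<beta> by (simp add: b_def)
  have step: "1 / 2 * dirac b F - 1 / 2 * dirac (- b) F =
      atomic {-1, 1 :: int} (\<lambda>e. of_int e / 2) (\<lambda>e. of_int e * b) F" if "F \<in> sets borel" for F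
    using that by (simp add: dirac_def measure_return atomic_def)
  have "signed_bernoulli \<beta> (Suc n) E =
      atomic (sign_lists n \<times> {-1, 1}) (\<lambda>(l, e). bernoulli_weight n l * (of_int e / 2))
        (\<lambda>(l, e). bernoulli_point \<beta> n l + of_int e * b) E"
    unfolding signed_bernoulli.simps b_def[symmetric]
  proof (rule signed_conv_atomic)
    \<comment> \<open>Since \<open>b\<close> is positive, the two atoms of opposite sign lie at
      distinct points.\<close>
    show "noncancelling {-1, 1 :: int} (\<lambda>e. of_int e / 2) (\<lambda>e. of_int e * b)"
      using b by (auto simp: noncancelling_def)
  qed (use Suc nc step finite_sign_lists in auto)
  also have "\<dots> = atomic (sign_lists (Suc n)) (bernoulli_weight (Suc n)) (bernoulli_point \<beta> (Suc n)) E"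
    unfolding sign_lists_Suc atomic_def
  proof (subst sum.reindex)
    show "inj_on (\<lambda>(l, e). e # l) (sign_lists n \<times> {-1, 1})" by (auto simp: inj_on_def)
    have weight: "bernoulli_weight (Suc n) (e # l) = bernoulli_weight n l * (of_int e / 2)" for e l
      by (simp add: bernoulli_weight_def mult.commute)
    have point: "bernoulli_point \<beta> (Suc n) (e # l) = bernoulli_point \<beta> n l + of_int e * b" for e l
      using \<beta> by (simp add: bernoulli_point_def b_def map_poly_pCons add_divide_distrib)
    show "(\<Sum>p\<in>sign_lists n \<times> {-1, 1}. (case p of (l, e) \<Rightarrow> bernoulli_weight n l * (of_int e / 2)) *
          indicator E (case p of (l, e) \<Rightarrow> bernoulli_point \<beta> n l + of_int e * b)) =
        sum ((\<lambda>l. bernoulli_weight (Suc n) l * indicator E (bernoulli_point \<beta> (Suc n) l)) \<circ> (\<lambda>(l, e). e # l))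
          (sign_lists n \<times> {-1, 1})"
      unfolding comp_def case_prod_unfold weight point ..
  qed
  finally show ?case .
qed

theorem proposition1:
  fixes m :: nat and \<beta> :: real
  assumes "m \<ge> 3" and "odd m"
    and "\<beta> > 1"
    and "\<beta> ^ m = (\<Sum>k<m. \<beta> ^ k)"
  shows "\<forall>n\<ge>1. tv_norm (signed_bernoulli \<beta> n) = 1"
proof (intro allI impI)
  fix n :: nat
  have nc: "noncancelling (sign_lists n) (bernoulli_weight n) (bernoulli_point \<beta> n)" for n
    unfolding noncancelling_def
  proof (intro ballI impI)
    fix l l'
    assume l: "l \<in> sign_lists n" "l' \<in> sign_lists n"
      and "bernoulli_point \<beta> n l = bernoulli_point \<beta> n l'"
    \<comment> \<open>Both points have the same nonzero denominator
      \<open>\<beta> ^ n\<close>.\<close>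
    then have "ipoly (Poly l) \<beta> = ipoly (Poly l') \<beta>"
      using assms(3) by (simp add: bernoulli_point_def)
    then have "prod_list l = prod_list l'"
      using prod_list_eq_if_multinacci_values_eq[of m \<beta> l n l'] assms l by simp
    then show "0 \<le> bernoulli_weight n l * bernoulli_weight n l'"
      by (simp add: bernoulli_weight_def)
  qed
  have "tv_norm (signed_bernoulli \<beta> n) = ennreal (\<Sum>l\<in>sign_lists n. \<bar>bernoulli_weight n l\<bar>)"
    using assms(3) by (intro tv_norm_atomic[OF finite_sign_lists _ nc] signed_bernoulli_atomic nc) simp_all
  \<comment> \<open>There are \<open>2 ^ n\<close> sign lists, each with a weight of modulus
    \<open>1 / 2 ^ n\<close>.\<close>
  also have "(\<Sum>l\<in>sign_lists n. \<bar>bernoulli_weight n l\<bar>) = (\<Sum>l\<in>sign_lists n. 1 / 2 ^ n)"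
    by (intro sum.cong refl) (auto simp: bernoulli_weight_def sign_lists_def dest: prod_list_sign_list)
  also have "\<dots> = 1" by (simp add: card_sign_lists)
  finally show "tv_norm (signed_bernoulli \<beta> n) = 1" by simp
qed

end
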